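(* Let $(W,S)$ be a Coxeter system. Suppose that $W'$ is the Coxeter group obtained from $W$ by adding a new generator $s$ to $S$, setting $m(s,t)\geq 3$ (possibly $\infty$) for some $t\in S$, and $m(s,s')=2$ for all $s'\in S$ with $s'\neq t$. Let $\mathsf{w}_i\in S^*$ be a reduced expression for $w_i\in W$ ($1\le i\le n$), and suppose that the concatenation $\mathsf{w}_1\mathsf{w}_2\cdots\mathsf{w}_n$ is reduced, and that each of $\mathsf{w}_2,\dots,\mathsf{w}_{n-1}$ contains at least one occurrence of $t$. Then $\mathsf{w}_1s\mathsf{w}_2s\mathsf{w}_3\cdots s\mathsf{w}_n$ is a reduced expression for an element of $W'$.
   Context: $(W,S)$ is a Coxeter system of finite rank: $W=\langle S\mid (st)^{m(s,t)}=1\rangle$, where $m(s,t)=m(t,s)\in\{1,2,\dots,\infty\}$, $m(s,t)=1$ iff $s=t$, and $m(s,t)=\infty$ means no relation. The bond strengths $m(a,b)$ for $a,b\in S$ are the same in $W'$ as in $W$. $S^*$ is the free monoid on $S$. A word representing a group element is an expression for it; it is reduced if it has minimal length among all expressions for that element. *)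

theory Defs
  imports "HOL-Algebra.Group" "HOL-Library.Extended_Nat"
begin

section \<open>Groups given by generators and relators\<close>

datatype 'a letter = Gen 'a | Inv 'a

definition gwords :: "'a set \<Rightarrow> 'a letter list set" where
  "gwords S = lists (Gen ` S \<union> Inv ` S)"

text \<open>Words over generators \<open>Gen x\<close> and formal inverses \<open>Inv x\<close>, modulo free cancellation and
  insertion or deletion of relators: equality in the free group on \<open>S\<close> modulo the normal
  closure of \<open>R\<close>. The intended use has \<open>R \<subseteq> gwords S\<close>.\<close>

inductive pres_eq :: "'a set \<Rightarrow> 'a letter list set \<Rightarrow> 'a letter list \<Rightarrow> 'a letter list \<Rightarrow> bool"
  for S R where
  pres_refl: "u \<in> gwords S \<Longrightarrow> pres_eq S R u u"
| pres_sym: "pres_eq S R u v \<Longrightarrow> pres_eq S R v u"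
| pres_trans: "pres_eq S R u v \<Longrightarrow> pres_eq S R v w \<Longrightarrow> pres_eq S R u w"
| pres_Gen_Inv: "u \<in> gwords S \<Longrightarrow> v \<in> gwords S \<Longrightarrow> x \<in> S \<Longrightarrow>
    pres_eq S R (u @ [Gen x, Inv x] @ v) (u @ v)"
| pres_Inv_Gen: "u \<in> gwords S \<Longrightarrow> v \<in> gwords S \<Longrightarrow> x \<in> S \<Longrightarrow>
    pres_eq S R (u @ [Inv x, Gen x] @ v) (u @ v)"
| pres_relator: "u \<in> gwords S \<Longrightarrow> v \<in> gwords S \<Longrightarrow> r \<in> R \<Longrightarrow>
    pres_eq S R (u @ r @ v) (u @ v)"

definition pres_class :: "'a set \<Rightarrow> 'a letter list set \<Rightarrow> 'a letter list \<Rightarrow> 'a letter list set" where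
  "pres_class S R u = {v. pres_eq S R u v}"

definition presented_group :: "'a set \<Rightarrow> 'a letter list set \<Rightarrow> 'a letter list set monoid" where
  "presented_group S R =
    \<lparr>carrier = pres_class S R ` gwords S,
     mult = (\<lambda>A B. \<Union>a\<in>A. \<Union>b\<in>B. pres_class S R (a @ b)),
     one = pres_class S R []\<rparr>"

lemma gwords_append [simp]: "u @ v \<in> gwords S \<longleftrightarrow> u \<in> gwords S \<and> v \<in> gwords S"
  by (auto simp: gwords_def)

lemma gwords_Nil [simp]: "[] \<in> gwords S"
  by (simp add: gwords_def)

lemma pres_eq_gwords:
  assumes "R \<subseteq> gwords S" "pres_eq S R u v"
  shows "u \<in> gwords S \<and> v \<in> gwords S"
  using assms(2,1) by induction (auto simp: gwords_def)

lemma pres_eq_context: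
  assumes "pres_eq S R u v" "a \<in> gwords S" "b \<in> gwords S"
  shows "pres_eq S R (a @ u @ b) (a @ v @ b)"
  using assms
proof induction
  case (pres_refl u)
  then show ?case by (simp add: pres_eq.pres_refl)
next
  case (pres_sym u v)
  then show ?case by (simp add: pres_eq.pres_sym)
next
  case (pres_trans u v w)
  then show ?case using pres_eq.pres_trans[of S R "a @ u @ b" "a @ v @ b" "a @ w @ b"] by simp
next
  case (pres_Gen_Inv u v x)
  then show ?case using pres_eq.pres_Gen_Inv[of "a @ u" S "v @ b" x R] by simp
next
  case (pres_Inv_Gen u v x)
  then show ?case using pres_eq.pres_Inv_Gen[of "a @ u" S "v @ b" x R] by simp
next
  case (pres_relator u v r)
  then show ?case using pres_eq.pres_relator[of "a @ u" S "v @ b" r R] by simp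
qed

lemma pres_eq_append:
  assumes "R \<subseteq> gwords S" "pres_eq S R u u'" "pres_eq S R v v'"
  shows "pres_eq S R (u @ v) (u' @ v')"
proof -
  have "pres_eq S R (u @ v) (u' @ v)"
    using pres_eq_context[OF assms(2), of "[]" v] pres_eq_gwords[OF assms(1,3)] by simp
  moreover have "pres_eq S R (u' @ v) (u' @ v')"
    using pres_eq_context[OF assms(3), of u' "[]"] pres_eq_gwords[OF assms(1,2)] by simp
  ultimately show ?thesis by (rule pres_trans)
qed

lemma pres_class_eq_iff:
  assumes "u \<in> gwords S"
  shows "pres_class S R u = pres_class S R v \<longleftrightarrow> pres_eq S R u v"
proof
  assume "pres_class S R u = pres_class S R v"
  moreover have "u \<in> pres_class S R u"
    using assms by (simp add: pres_class_def pres_refl)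
  ultimately show "pres_eq S R u v" by (simp add: pres_class_def pres_sym)
next
  assume uv: "pres_eq S R u v"
  have "pres_eq S R u w \<longleftrightarrow> pres_eq S R v w" for w
    using pres_trans[OF uv, of w] pres_trans[OF pres_sym[OF uv], of w] by blast
  then show "pres_class S R u = pres_class S R v" by (simp add: pres_class_def)
qed

lemma presented_group_mult:
  assumes "R \<subseteq> gwords S" "u \<in> gwords S" "v \<in> gwords S"
  shows "pres_class S R u \<otimes>\<^bsub>presented_group S R\<^esub> pres_class S R v = pres_class S R (u @ v)"
proof -
  have "pres_class S R (a @ b) = pres_class S R (u @ v)"
    if "a \<in> pres_class S R u" "b \<in> pres_class S R v" for a b
  proof -
    have "pres_eq S R (u @ v) (a @ b)"
      using that pres_eq_append[OF assms(1)] by (simp add: pres_class_def)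
    then show ?thesis using assms pres_class_eq_iff[of "u @ v" S R "a @ b"] by simp
  qed
  moreover have "u \<in> pres_class S R u" "v \<in> pres_class S R v"
    using assms by (auto simp: pres_class_def intro: pres_refl)
  ultimately have "(\<Union>a\<in>pres_class S R u. \<Union>b\<in>pres_class S R v. pres_class S R (a @ b)) =
      pres_class S R (u @ v)" by blast
  then show ?thesis by (simp add: presented_group_def)
qed

lemma pres_eq_left_inverse:
  assumes "u \<in> gwords S"
  shows "\<exists>v\<in>gwords S. pres_eq S R (v @ u) []"
  using assms
proof (induction u)
  case Nil
  show ?case by (rule bexI[of _ "[]"]) (auto intro: pres_refl)
next
  case (Cons l u)
  then have u: "u \<in> gwords S" by (simp add: gwords_def)
  then obtain v where v: "v \<in> gwords S" "pres_eq S R (v @ u) []" using Cons.IH by blast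
  from Cons.prems consider x where "l = Gen x" "x \<in> S" | x where "l = Inv x" "x \<in> S"
    by (auto simp: gwords_def)
  then show ?case
  proof cases
    case 1
    then have "pres_eq S R (v @ [Inv x, Gen x] @ u) (v @ u)" using u v by (intro pres_Inv_Gen)
    from pres_trans[OF this v(2)] have "pres_eq S R ((v @ [Inv x]) @ l # u) []" using 1 by simp
    moreover have "v @ [Inv x] \<in> gwords S" using v 1 by (simp add: gwords_def)
    ultimately show ?thesis by blast
  next
    case 2
    then have "pres_eq S R (v @ [Gen x, Inv x] @ u) (v @ u)" using u v by (intro pres_Gen_Inv)
    from pres_trans[OF this v(2)] have "pres_eq S R ((v @ [Gen x]) @ l # u) []" using 2 by simp
    moreover have "v @ [Gen x] \<in> gwords S" using v 2 by (simp add: gwords_def)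
    ultimately show ?thesis by blast
  qed
qed

lemma group_presented_group:
  assumes R: "R \<subseteq> gwords S"
  shows "group (presented_group S R)"
proof (rule groupI)
  have car: "carrier (presented_group S R) = pres_class S R ` gwords S"
    and one: "\<one>\<^bsub>presented_group S R\<^esub> = pres_class S R []"
    by (simp_all add: presented_group_def)
  note mult = presented_group_mult[OF R]
  show "\<one>\<^bsub>presented_group S R\<^esub> \<in> carrier (presented_group S R)"
    by (simp add: car one)
  show "x \<otimes>\<^bsub>presented_group S R\<^esub> y \<in> carrier (presented_group S R)"
    if "x \<in> carrier (presented_group S R)" "y \<in> carrier (presented_group S R)" for x y
    using that by (auto simp: car mult)
  show "x \<otimes>\<^bsub>presented_group S R\<^esub> y \<otimes>\<^bsub>presented_group S R\<^esub> z =
      x \<otimes>\<^bsub>presented_group S R\<^esub> (y \<otimes>\<^bsub>presented_group S R\<^esub> z)"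
    if "x \<in> carrier (presented_group S R)" "y \<in> carrier (presented_group S R)"
      "z \<in> carrier (presented_group S R)" for x y z
    using that by (auto simp: car mult)
  show "\<one>\<^bsub>presented_group S R\<^esub> \<otimes>\<^bsub>presented_group S R\<^esub> x = x"
    if "x \<in> carrier (presented_group S R)" for x
    using that by (auto simp: car one mult)
  show "\<exists>y\<in>carrier (presented_group S R).
      y \<otimes>\<^bsub>presented_group S R\<^esub> x = \<one>\<^bsub>presented_group S R\<^esub>"
    if x: "x \<in> carrier (presented_group S R)" for x
  proof -
    from x obtain u where u: "u \<in> gwords S" "x = pres_class S R u" by (auto simp: car)
    then obtain v where "v \<in> gwords S" "pres_eq S R (v @ u) []"
      using pres_eq_left_inverse by blast
    then show ?thesis using u by (auto simp: car one mult pres_class_eq_iff)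
  qed
qed

section \<open>Coxeter groups\<close>

definition coxeter_matrix :: "'a set \<Rightarrow> ('a \<Rightarrow> 'a \<Rightarrow> enat) \<Rightarrow> bool" where
  "coxeter_matrix S m \<longleftrightarrow> finite S \<and>
    (\<forall>a\<in>S. \<forall>b\<in>S. 1 \<le> m a b \<and> m a b = m b a \<and> (m a b = 1 \<longleftrightarrow> a = b))"

text \<open>The value \<open>m a a = 1\<close> gives the relator \<open>a a\<close>; pairs with \<open>m a b = \<infinity>\<close> contribute no relator.\<close>

definition coxeter_relators :: "'a set \<Rightarrow> ('a \<Rightarrow> 'a \<Rightarrow> enat) \<Rightarrow> 'a letter list set" where
  "coxeter_relators S m =
    {concat (replicate k [Gen a, Gen b]) | a b k. a \<in> S \<and> b \<in> S \<and> m a b = enat k}"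

definition coxeter_group :: "'a set \<Rightarrow> ('a \<Rightarrow> 'a \<Rightarrow> enat) \<Rightarrow> 'a letter list set monoid" where
  "coxeter_group S m = presented_group S (coxeter_relators S m)"

lemma coxeter_relators_gwords: "coxeter_relators S m \<subseteq> gwords S"
  by (auto simp: coxeter_relators_def gwords_def split: if_splits)

lemma group_coxeter_group: "group (coxeter_group S m)"
  unfolding coxeter_group_def by (intro group_presented_group coxeter_relators_gwords)

text \<open>Expressions are words in the free monoid \<open>lists S\<close>, without formal inverses.\<close>

definition coxeter_elem :: "'a set \<Rightarrow> ('a \<Rightarrow> 'a \<Rightarrow> enat) \<Rightarrow> 'a list \<Rightarrow> 'a letter list set" where
  "coxeter_elem S m u = pres_class S (coxeter_relators S m) (map Gen u)"

definition expression_for :: "'a set \<Rightarrow> ('a \<Rightarrow> 'a \<Rightarrow> enat) \<Rightarrow> 'a list \<Rightarrow> 'a letter list set \<Rightarrow> bool" where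
  "expression_for S m u g \<longleftrightarrow> u \<in> lists S \<and> coxeter_elem S m u = g"

definition reduced_expression_for ::
    "'a set \<Rightarrow> ('a \<Rightarrow> 'a \<Rightarrow> enat) \<Rightarrow> 'a list \<Rightarrow> 'a letter list set \<Rightarrow> bool" where
  "reduced_expression_for S m u g \<longleftrightarrow>
    expression_for S m u g \<and> (\<forall>v. expression_for S m v g \<longrightarrow> length u \<le> length v)"

definition reduced_word :: "'a set \<Rightarrow> ('a \<Rightarrow> 'a \<Rightarrow> enat) \<Rightarrow> 'a list \<Rightarrow> bool" where
  "reduced_word S m u \<longleftrightarrow> reduced_expression_for S m u (coxeter_elem S m u)"

end

theory Submission
  imports Defs Complex_Main "HOL-Library.Sublist"
begin

text \<open>By the theorem of Tits on the geometric representation, a word is reduced iff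
  \<open>p \<alpha>\<^sub>a\<close> is a nonnegative combination of simple roots for each of its prefixes \<open>p a\<close>. Given
  a prefix of \<open>w\<^sub>1 s w\<^sub>2 s \<dots> s w\<^sub>n\<close>, apply its letters to the simple root from right to left and write the
  current vector as \<open>v + k \<alpha>\<^sub>s\<close> with \<open>v\<close> in the span of the roots of \<open>W\<close>. Let \<open>c = - 2 B(\<alpha>\<^sub>s, \<alpha>\<^sub>t)\<close>; since
  \<open>m(s, t) \<ge> 3\<close>, \<open>c \<ge> 1\<close>. The letter \<open>s\<close> replaces \<open>k\<close> by \<open>c v\<^sub>t - k\<close>. A word \<open>w\<close> over \<open>S\<close> fixes \<open>k\<close> and
  replaces \<open>v\<close> by \<open>w v + k (w \<alpha>\<^sub>s - \<alpha>\<^sub>s)\<close>, where \<open>w \<alpha>\<^sub>s - \<alpha>\<^sub>s\<close> is \<open>c\<close> times a sum of positive roots,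
  one for each occurrence of \<open>t\<close> in \<open>w\<close>. Because \<open>w\<^sub>1 \<dots> w\<^sub>n\<close> is reduced, these stay positive under
  the remaining letters from \<open>S\<close>; and if \<open>t\<close> occurs in \<open>w\<close>, then afterwards \<open>v\<^sub>t \<ge> c k \<ge> k\<close>, so the
  next \<open>s\<close> leaves \<open>k\<close> nonnegative.\<close>

section \<open>The geometric representation\<close>

text \<open>Vectors are functions on the whole type; the roots are supported on \<open>S\<close>.\<close>

definition cos_form :: "('a \<Rightarrow> 'a \<Rightarrow> enat) \<Rightarrow> 'a \<Rightarrow> 'a \<Rightarrow> real" where
  "cos_form m a b = (case m a b of enat k \<Rightarrow> - cos (pi / k) | \<infinity> \<Rightarrow> -1)"

definition pairing :: "'a set \<Rightarrow> ('a \<Rightarrow> 'a \<Rightarrow> enat) \<Rightarrow> 'a \<Rightarrow> ('a \<Rightarrow> real) \<Rightarrow> real" where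
  "pairing S m a v = (\<Sum>b\<in>S. cos_form m a b * v b)"

definition reflect :: "'a set \<Rightarrow> ('a \<Rightarrow> 'a \<Rightarrow> enat) \<Rightarrow> 'a \<Rightarrow> ('a \<Rightarrow> real) \<Rightarrow> 'a \<Rightarrow> real" where
  "reflect S m a v = v(a := v a - 2 * pairing S m a v)"

abbreviation act :: "'a set \<Rightarrow> ('a \<Rightarrow> 'a \<Rightarrow> enat) \<Rightarrow> 'a list \<Rightarrow> ('a \<Rightarrow> real) \<Rightarrow> 'a \<Rightarrow> real" where
  "act S m \<equiv> foldr (reflect S m)"

definition simple_root :: "'a \<Rightarrow> 'a \<Rightarrow> real" where
  "simple_root a = (\<lambda>x. if x = a then 1 else 0)"

definition nonneg :: "('a \<Rightarrow> real) \<Rightarrow> bool" where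
  "nonneg v \<longleftrightarrow> (\<forall>x. 0 \<le> v x)"

text \<open>Generators act as involutions, so a letter and its formal inverse may act alike.\<close>

primrec base :: "'a letter \<Rightarrow> 'a" where
  "base (Gen a) = a"
| "base (Inv a) = a"

lemma base_Gen: "base \<circ> Gen = id"
  by auto

text \<open>The alternating word of length \<open>k\<close> whose last letter is \<open>a\<close>.\<close>

primrec alt :: "'a \<Rightarrow> 'a \<Rightarrow> nat \<Rightarrow> 'a list" where
  "alt a b 0 = []"
| "alt a b (Suc k) = (if even k then a else b) # alt a b k"

lemma length_alt [simp]: "length (alt a b k) = k"
  by (induction k) auto

lemma alt_in_lists: "a \<in> S \<Longrightarrow> b \<in> S \<Longrightarrow> alt a b k \<in> lists S"
  by (induction k) auto

lemma alt_add: "\<exists>y. length y = j \<and> alt a b (j + k) = y @ alt a b k"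
proof (induction j)
  case 0
  then show ?case by simp
next
  case (Suc j)
  then obtain y where "length y = j" "alt a b (j + k) = y @ alt a b k" by blast
  then show ?case by (intro exI[of _ "(if even (j + k) then a else b) # y"]) auto
qed

lemma alt_snoc: "\<exists>z. length z = k \<and> alt a b (Suc k) = z @ [a]"
  using alt_add[of k a b 1] by simp

lemma alt_double: "alt a b (2 * k) = concat (replicate k [b, a])"
  by (induction k) auto

text \<open>For \<open>j = k\<close> this splits a relator into the inverse of one side of the braid
  relation followed by the other side.\<close>

lemma alt_rev_append:
  assumes "j \<le> 2 * k"
  shows "alt a b (2 * k) = rev (alt b a j) @ alt a b (2 * k - j)"
  using assms
proof (induction j)
  case 0
  then show ?case by simp
next
  case (Suc j)
  then have "2 * k - j = Suc (2 * k - Suc j)" by simp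
  moreover have "even (2 * k - Suc j) \<longleftrightarrow> odd j" using Suc.prems by auto
  ultimately show ?case using Suc by simp
qed

lemma reflect_lin:
  "reflect S m a (\<lambda>x. c * v x + d * w x) = (\<lambda>x. c * reflect S m a v x + d * reflect S m a w x)"
  by (auto simp: reflect_def pairing_def fun_eq_iff sum.distrib algebra_simps sum_distrib_left)

lemma act_lin:
  "act S m u (\<lambda>x. c * v x + d * w x) = (\<lambda>x. c * act S m u v x + d * act S m u w x)"
  by (induction u) (auto simp: reflect_lin)

lemma act_add: "act S m u (\<lambda>x. v x + w x) = (\<lambda>x. act S m u v x + act S m u w x)"
  using act_lin[of S m u 1 v 1 w] by simp

lemma act_scale: "act S m u (\<lambda>x. c * v x) = (\<lambda>x. c * act S m u v x)"
  using act_lin[of S m u c v 0 v] by simp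

lemma nonneg_add: "nonneg v \<Longrightarrow> nonneg w \<Longrightarrow> nonneg (\<lambda>x. v x + w x)"
  by (simp add: nonneg_def)

lemma nonneg_scale: "0 \<le> c \<Longrightarrow> nonneg v \<Longrightarrow> nonneg (\<lambda>x. c * v x)"
  by (simp add: nonneg_def)

lemma nonneg_simple_root [simp]: "nonneg (simple_root a)"
  by (simp add: nonneg_def simple_root_def)

lemma pairing_simple_root: "finite S \<Longrightarrow> b \<in> S \<Longrightarrow> pairing S m a (simple_root b) = cos_form m a b"
  by (simp add: pairing_def simple_root_def if_distrib cong: if_cong)

lemma pairing_update:
  assumes "finite S" "b \<in> S"
  shows "pairing S m a (v(b := v b + r)) = pairing S m a v + cos_form m a b * r"
proof -
  have "v(b := v b + r) = (\<lambda>x. v x + r * simple_root b x)"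
    by (auto simp: simple_root_def)
  then show ?thesis
    using assms pairing_simple_root[OF assms, of m a]
    by (simp add: pairing_def algebra_simps sum.distrib flip: sum_distrib_left)
qed

text \<open>The arguments advance by \<open>2 * pi / k\<close> in \<open>k\<close> steps and so run
  once around the circle. Up to a factor, the sums are the total multiples of the two roots
  subtracted in \<open>k\<close> rounds of reflections.\<close>

lemma sin_sum_zero:
  fixes x y :: real and k :: nat
  assumes k: "k \<ge> 2"
  shows "(\<Sum>i<k. x * sin ((2 * real i + 1) * (pi / k)) + y * sin (2 * real i * (pi / k))) = 0"
      (is "?T = 0")
    and "(\<Sum>i<k. x * sin ((2 * real i + 2) * (pi / k)) + y * sin ((2 * real i + 1) * (pi / k))) = 0"
proof -
  have sin0: "(\<Sum>i<k. sin (2 * real i * (pi / k) + z)) = 0" for z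
  proof -
    define g where "g = (\<lambda>i::nat. sin (2 * real i * (pi / k) + z))"
    define th where "th = 2 * pi / k"
    \<comment> \<open>By periodicity, summing \<open>g (i + 2) + g i = 2 cos th g (i + 1)\<close> over a period
      gives \<open>2 T = 2 cos th T\<close> for the sum \<open>T\<close>.\<close>
    have g: "g i = sin (real i * th + z)" for i by (simp add: g_def th_def mult_ac)
    have per: "g (i + k) = g i" for i
    proof -
      have "real (i + k) * th + z = (real i * th + z) + 2 * pi"
        using k by (simp add: th_def field_simps)
      then show ?thesis unfolding g by (metis sin_periodic)
    qed
    have step: "g (i + 2) + g i = 2 * cos th * g (i + 1)" for i
    proof -
      let ?x = "real (i + 1) * th + z"
      have "g (i + 2) = sin (?x + th)" "g i = sin (?x - th)"
        by (simp_all add: g algebra_simps)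
      then show ?thesis by (simp add: g sin_add sin_diff)
    qed
    have shift: "(\<Sum>i<k. g (i + j)) = (\<Sum>i<k. g i)" for j
    proof (induction j)
      case (Suc j)
      have "(\<Sum>i<k. g (i + Suc j)) + g j = (\<Sum>i<Suc k. g (i + j))"
        by (subst sum.lessThan_Suc_shift) simp
      also have "\<dots> = (\<Sum>i<k. g (i + j)) + g j"
        using per[of j] by (simp add: add.commute)
      finally show ?case using Suc by simp
    qed simp
    have "(\<Sum>i<k. g (i + 2) + g i) = 2 * cos th * (\<Sum>i<k. g (i + 1))"
      unfolding step by (simp add: sum_distrib_left)
    then have "2 * (\<Sum>i<k. g i) = 2 * cos th * (\<Sum>i<k. g i)"
      using shift[of 2] shift[of 1] by (simp add: sum.distrib)
    \<comment> \<open>Here \<open>k \<ge> 2\<close> enters: the angle \<open>th\<close> is positive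
      and at most \<open>pi\<close>.\<close>
    moreover have "cos th < 1"
    proof -
      have "0 < th" "th \<le> pi" using k by (auto simp: th_def field_simps)
      then show ?thesis using cos_monotone_0_pi[of 0 th] by simp
    qed
    ultimately have "(\<Sum>i<k. g i) = 0" by auto
    then show ?thesis by (simp add: g_def)
  qed
  from sin0[of "pi / k"] sin0[of 0] show "?T = 0"
    by (simp add: sum.distrib algebra_simps flip: sum_distrib_left)
  from sin0[of "2 * (pi / k)"] sin0[of "pi / k"]
  show "(\<Sum>i<k. x * sin ((2 * real i + 2) * (pi / k)) + y * sin ((2 * real i + 1) * (pi / k))) = 0"
    by (simp add: sum.distrib algebra_simps flip: sum_distrib_left)
qed

lemma act_concat_replicate: "act S m (concat (replicate k u)) = (act S m u) ^^ k"
  by (induction k) (auto simp: comp_def)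

section \<open>Reflections satisfy the Coxeter relations\<close>

locale coxeter_system =
  fixes S :: "'a set" and m :: "'a \<Rightarrow> 'a \<Rightarrow> enat"
  assumes matrix: "coxeter_matrix S m"
begin

lemma finS: "finite S"
  and m_sym: "a \<in> S \<Longrightarrow> b \<in> S \<Longrightarrow> m a b = m b a"
  and m_ge: "a \<in> S \<Longrightarrow> b \<in> S \<Longrightarrow> 1 \<le> m a b"
  and m_one: "a \<in> S \<Longrightarrow> b \<in> S \<Longrightarrow> m a b = 1 \<longleftrightarrow> a = b"
  using matrix by (auto simp: coxeter_matrix_def)

lemma m_diag: "a \<in> S \<Longrightarrow> m a a = enat 1"
  using m_one[of a a] by (simp add: one_enat_def)

lemma cos_form_diag: "a \<in> S \<Longrightarrow> cos_form m a a = 1"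
  using m_diag[of a] by (simp add: cos_form_def)

lemma cos_form_sym: "a \<in> S \<Longrightarrow> b \<in> S \<Longrightarrow> cos_form m a b = cos_form m b a"
  using m_sym[of a b] by (simp add: cos_form_def)

lemma m_ge_2:
  assumes "a \<in> S" "b \<in> S" "a \<noteq> b" "m a b = enat k"
  shows "2 \<le> k"
proof -
  have "1 \<le> enat k" "enat k \<noteq> 1" using assms m_ge[of a b] m_one[of a b] by auto
  then show ?thesis by (auto simp: one_enat_def)
qed

lemma reflect_update: "reflect S m a v = v(a := v a + (- 2 * pairing S m a v))"
  by (simp add: reflect_def)

lemma pairing_reflect:
  assumes "b \<in> S"
  shows "pairing S m a (reflect S m b v) = pairing S m a v - 2 * cos_form m a b * pairing S m b v"
  unfolding reflect_update pairing_update[OF finS assms] by simp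

lemma reflect_reflect [simp]:
  assumes "a \<in> S"
  shows "reflect S m a (reflect S m a v) = v"
  using pairing_reflect[OF assms, of a v] cos_form_diag[OF assms]
  by (auto simp: fun_eq_iff reflect_def)

lemma reflect_simple_root:
  assumes "a \<in> S" "b \<in> S"
  shows "reflect S m a (simple_root b) =
    (\<lambda>x. simple_root b x - 2 * cos_form m a b * simple_root a x)"
  unfolding reflect_def pairing_simple_root[OF finS assms(2)]
  by (auto simp: fun_eq_iff simple_root_def)

text \<open>Following an arbitrary vector through the reflections and totalling what is subtracted
  avoids splitting off the plane of the two roots.\<close>

lemma reflect_power:
  assumes ab: "a \<in> S" "b \<in> S" "a \<noteq> b" and k: "m a b = enat k"
  shows "(act S m [a, b] ^^ k) v = v"
proof -
  define th where "th = pi / k"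
  define p q where "p = pairing S m a v" and "q = pairing S m b v"
  \<comment> \<open>Applying \<open>b, a, b, a, \<dots>\<close> to \<open>v\<close> subtracts \<open>2 r j\<close> times the respective simple root at step \<open>j\<close>.\<close>
  define r where "r = (\<lambda>j. (q * sin ((j + 1) * th) + p * sin (j * th)) / sin th)"
  have k2: "2 \<le> k" using m_ge_2 assms by blast
  have "0 < th" "th < pi" using k2 by (auto simp: th_def field_simps)
  then have sin_pos: "0 < sin th" by (rule sin_gt_zero)
  have c: "cos_form m a b = - cos th" "cos_form m b a = - cos th"
    using k cos_form_sym[OF ab(1,2)] by (simp_all add: cos_form_def th_def)
  \<comment> \<open>A reflection changes the pairing with the other root by
    \<open>2 * cos th\<close> times the current coefficient, whence this recurrence.\<close>
  have r_rec: "r (j + 1) + r (j - 1) = 2 * cos th * r j" for j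
  proof -
    have "sin ((j + 1 + 1) * th) + sin ((j - 1 + 1) * th) = 2 * cos th * sin ((j + 1) * th)"
      using sin_add[of "(j + 1) * th" th] sin_diff[of "(j + 1) * th" th]
      by (simp add: algebra_simps)
    moreover have "sin ((j + 1) * th) + sin ((j - 1) * th) = 2 * cos th * sin (j * th)"
      using sin_add[of "j * th" th] sin_diff[of "j * th" th]
      by (simp add: algebra_simps)
    moreover have "r (j + 1) + r (j - 1) = (q * (sin ((j + 1 + 1) * th) + sin ((j - 1 + 1) * th))
        + p * (sin ((j + 1) * th) + sin ((j - 1) * th))) / sin th"
      by (simp add: r_def add_divide_distrib algebra_simps)
    ultimately show ?thesis by (simp add: r_def algebra_simps)
  qed
  \<comment> \<open>\<open>r (-1)\<close> belongs to an imagined earlier reflection in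
    \<open>a\<close>, which would leave \<open>p\<close> as pairing with \<open>a\<close>.\<close>
  have r0: "r 0 = q" "r (-1) = - p" using sin_pos by (simp_all add: r_def)
  define f where "f = (\<lambda>i. (act S m [a, b] ^^ i) v)"
  have inv: "pairing S m b (f i) = r (2 * real i) \<and> pairing S m a (f i) = - r (2 * real i - 1) \<and>
     f i = (\<lambda>x. v x - 2 * (\<Sum>j<i. r (2 * real j)) * simple_root b x
              - 2 * (\<Sum>j<i. r (2 * real j + 1)) * simple_root a x)" for i
  proof (induction i)
    case 0
    show ?case by (simp add: f_def r0 p_def q_def)
  next
    case (Suc i)
    have IH: "pairing S m b (f i) = r (2 * real i)" "pairing S m a (f i) = - r (2 * real i - 1)"
      using Suc by blast+
    define g where "g = reflect S m b (f i)"
    have f: "f (Suc i) = reflect S m a g" by (simp add: f_def g_def)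
    have gb: "pairing S m b g = - r (2 * real i)"
      using IH(1) pairing_reflect[OF ab(2), of b "f i"] cos_form_diag[OF ab(2)] by (simp add: g_def)
    have ga: "pairing S m a g = r (2 * real i + 1)"
      using IH(1,2) pairing_reflect[OF ab(2), of a "f i"] c r_rec[of "2 * real i"] by (simp add: g_def add.commute)
    have "pairing S m a (f (Suc i)) = - r (2 * real i + 1)"
      using pairing_reflect[OF ab(1), of a g] ga cos_form_diag[OF ab(1)] by (simp add: f)
    moreover have "pairing S m b (f (Suc i)) = r (2 * real i + 2)"
      using pairing_reflect[OF ab(1), of b g] ga gb c r_rec[of "2 * real i + 1"] by (simp add: f add.commute)
    moreover have "f (Suc i) = (\<lambda>x. f i x - 2 * r (2 * real i) * simple_root b x
        - 2 * r (2 * real i + 1) * simple_root a x)"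
      using IH(1) ga by (auto simp: f g_def reflect_def simple_root_def fun_eq_iff)
    moreover have "f i = (\<lambda>x. v x - 2 * (\<Sum>j<i. r (2 * real j)) * simple_root b x
              - 2 * (\<Sum>j<i. r (2 * real j + 1)) * simple_root a x)"
      using Suc by blast
    ultimately show ?case by (simp add: fun_eq_iff) (simp add: algebra_simps)
  qed
  have "(\<Sum>j<k. r (2 * real j)) = 0" "(\<Sum>j<k. r (2 * real j + 1)) = 0"
    using sin_sum_zero[OF k2, of q p]
    by (simp_all add: r_def th_def add.commute flip: sum_divide_distrib)
  with inv[of k] show ?thesis by (simp add: f_def)
qed

lemma act_relator:
  assumes "r \<in> coxeter_relators S m"
  shows "act S m (map base r) = id"
proof -
  obtain a b k where r: "r = concat (replicate k [Gen a, Gen b])" "a \<in> S" "b \<in> S" "m a b = enat k"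
    using assms by (auto simp: coxeter_relators_def)
  have "map base r = concat (replicate k [a, b])"
    by (simp add: r map_concat map_replicate)
  then have eq: "act S m (map base r) = act S m [a, b] ^^ k" by (simp add: act_concat_replicate)
  show ?thesis
  proof (cases "a = b")
    case True
    then have "k = 1" using r m_diag by simp
    with eq True r show ?thesis by (auto simp: fun_eq_iff)
  next
    case False
    with eq reflect_power[OF r(2,3) _ r(4)] show ?thesis by (auto simp: fun_eq_iff)
  qed
qed

text \<open>Relators act trivially and reflections are involutions, so each generating step of the
  congruence preserves the action.\<close>

lemma pres_eq_act:
  assumes "pres_eq S (coxeter_relators S m) u v"
  shows "act S m (map base u) = act S m (map base v)"
  using assms
proof induction
  case (pres_relator u v r)
  then show ?case by (simp add: act_relator)
qed (auto simp: fun_eq_iff)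

section \<open>Words up to equality in the group\<close>

definition weq :: "'a list \<Rightarrow> 'a list \<Rightarrow> bool" where
  "weq u v \<longleftrightarrow> pres_eq S (coxeter_relators S m) (map Gen u) (map Gen v)"

lemma map_Gen_gwords: "map Gen u \<in> gwords S \<longleftrightarrow> u \<in> lists S"
  by (auto simp: gwords_def)

lemma weq_lists: "weq u v \<Longrightarrow> u \<in> lists S \<and> v \<in> lists S"
  using pres_eq_gwords[OF coxeter_relators_gwords] by (auto simp: weq_def map_Gen_gwords[symmetric])

lemma weq_refl: "u \<in> lists S \<Longrightarrow> weq u u"
  by (simp add: weq_def map_Gen_gwords pres_refl)

lemma weq_sym: "weq u v \<Longrightarrow> weq v u"
  by (simp add: weq_def pres_sym)

lemma weq_trans [trans]: "weq u v \<Longrightarrow> weq v w \<Longrightarrow> weq u w"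
  unfolding weq_def by (rule pres_trans)

lemma weq_append: "weq u u' \<Longrightarrow> weq v v' \<Longrightarrow> weq (u @ v) (u' @ v')"
  by (simp add: weq_def pres_eq_append coxeter_relators_gwords)

lemma weq_act: "weq u v \<Longrightarrow> act S m u = act S m v"
  using pres_eq_act[of "map Gen u" "map Gen v"] by (simp add: weq_def base_Gen)

lemma weq_power:
  assumes "a \<in> S" "b \<in> S" "m a b = enat k"
  shows "weq (concat (replicate k [a, b])) []"
proof -
  have "concat (replicate k [Gen a, Gen b]) \<in> coxeter_relators S m"
    using assms by (auto simp: coxeter_relators_def)
  from pres_relator[OF _ _ this, of "[]" S "[]"] show ?thesis
    by (simp add: weq_def map_concat map_replicate)
qed

lemma weq_square: "a \<in> S \<Longrightarrow> weq [a, a] []"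
  using weq_power[of a a 1] m_diag by simp

lemma weq_rev_append: "u \<in> lists S \<Longrightarrow> weq (u @ rev u) []"
proof (induction u rule: rev_induct)
  case Nil
  then show ?case by (simp add: weq_refl)
next
  case (snoc a u)
  have "weq (u @ [a, a] @ rev u) (u @ [] @ rev u)"
    using snoc.prems by (intro weq_append weq_square weq_refl) auto
  also have "weq (u @ [] @ rev u) []" using snoc by simp
  finally show ?case by simp
qed

text \<open>With \<open>u\<close> and \<open>v\<close> the two sides, \<open>rev u @ v\<close> is a
  relator; hence \<open>u @ rev u @ v\<close> equals both \<open>u\<close> and \<open>v\<close> in
  the group.\<close>

lemma weq_braid:
  assumes ab: "a \<in> S" "b \<in> S" and k: "m a b = enat k"
  shows "weq (alt a b k) (alt b a k)"
proof -
  let ?u = "alt b a k" and ?v = "alt a b k"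
  have uv: "?u \<in> lists S" "?v \<in> lists S" using ab by (simp_all only: alt_in_lists)
  have "weq (rev ?u @ ?v) []"
    using weq_power[OF ab(2,1)] k m_sym[OF ab] alt_double[of a b k] alt_rev_append[of k k a b] by simp
  from weq_append[OF weq_refl[OF uv(1)] this] have 1: "weq (?u @ rev ?u @ ?v) ?u" by simp
  from weq_append[OF weq_rev_append[OF uv(1)] weq_refl[OF uv(2)]]
  have "weq (?u @ rev ?u @ ?v) ?v" by simp
  from weq_trans[OF weq_sym[OF this] 1] show ?thesis .
qed

lemma reduced_word_iff:
  "reduced_word S m u \<longleftrightarrow> u \<in> lists S \<and> (\<forall>v. weq u v \<longrightarrow> length u \<le> length v)"
proof (cases "u \<in> lists S")
  case True
  then have "expression_for S m v (coxeter_elem S m u) \<longleftrightarrow> weq u v" for v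
    using pres_class_eq_iff[of "map Gen u" S "coxeter_relators S m" "map Gen v"] weq_lists[of u v]
    by (auto simp: expression_for_def coxeter_elem_def weq_def map_Gen_gwords)
  with True show ?thesis
    by (auto simp: reduced_word_def reduced_expression_for_def weq_refl)
qed (auto simp: reduced_word_def reduced_expression_for_def expression_for_def)

lemma reduced_wordD: "reduced_word S m u \<Longrightarrow> weq u v \<Longrightarrow> length u \<le> length v"
  by (simp add: reduced_word_iff)

lemma reduced_word_lists: "reduced_word S m u \<Longrightarrow> u \<in> lists S"
  by (simp add: reduced_word_iff)

lemma reduced_word_factor:
  assumes "reduced_word S m (p @ u @ q)"
  shows "reduced_word S m u"
  unfolding reduced_word_iff
proof (intro conjI allI impI)
  have l: "p @ u @ q \<in> lists S" using assms by (rule reduced_word_lists)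
  then show "u \<in> lists S" by simp
  fix v assume "weq u v"
  then have "weq (p @ u @ q) (p @ v @ q)" using l by (intro weq_append weq_refl) auto
  from reduced_wordD[OF assms this] show "length u \<le> length v" by simp
qed

lemma ex_reduced_word:
  assumes "u \<in> lists S"
  shows "\<exists>v. weq u v \<and> reduced_word S m v"
proof -
  obtain v where v: "weq u v" and min: "\<And>v'. weq u v' \<Longrightarrow> length v \<le> length v'"
    using ex_has_least_nat[of "weq u" u length] weq_refl[OF assms] by blast
  have "reduced_word S m v"
    unfolding reduced_word_iff using weq_lists[OF v] min[OF weq_trans[OF v]] by blast
  with v show ?thesis by blast
qed

section \<open>Rank two, and Tits' theorem on positive roots\<close>

lemma reflect_lincomb:
  assumes "a \<in> S" "b \<in> S"
  shows "reflect S m a (\<lambda>x. y * simple_root b x + z * simple_root a x) =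
    (\<lambda>x. y * simple_root b x + (- 2 * cos_form m a b * y - z) * simple_root a x)"
  by (simp add: reflect_lin reflect_simple_root[OF assms(1)] assms cos_form_diag
      fun_eq_iff algebra_simps)

text \<open>Keeping the Chebyshev sequence \<open>u\<close> abstract lets finite and infinite bonds
  share the computation. Each reflection replaces the older coefficient by the next term, hence the
  parity cases.\<close>

lemma act_alt:
  assumes ab: "a \<in> S" "b \<in> S"
    and u: "u 0 = 0" "u 1 = 1" "\<And>k. u (Suc (Suc k)) = - 2 * cos_form m a b * u (Suc k) - u k"
  shows "act S m (alt a b k) (simple_root b) =
    (\<lambda>x. u (Suc k) * simple_root (if even k then b else a) x
       + u k * simple_root (if even k then a else b) x)"
proof (induction k)
  case 0
  then show ?case using u by simp
next
  case (Suc k)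
  then show ?case
    using reflect_lincomb[OF ab, of "u (Suc k)" "u k"] reflect_lincomb[OF ab(2,1), of "u (Suc k)" "u k"]
      u(3)[of k] cos_form_sym[OF ab] by (cases "even k") (simp_all add: add.commute)
qed

lemma act_alt_nonneg:
  assumes ab: "a \<in> S" "b \<in> S" "a \<noteq> b" and k: "enat k < m a b"
  shows "\<exists>y z. 0 \<le> y \<and> 0 \<le> z \<and>
    act S m (alt a b k) (simple_root b) = (\<lambda>x. y * simple_root a x + z * simple_root b x)"
proof -
  obtain u :: "nat \<Rightarrow> real" where u: "u 0 = 0" "u 1 = 1"
      "\<And>k. u (Suc (Suc k)) = - 2 * cos_form m a b * u (Suc k) - u k"
    and pos: "0 \<le> u k" "0 \<le> u (Suc k)"
  proof (cases "m a b")
    case infinity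
    \<comment> \<open>For form value -1 the recurrence is solved by \<open>u k = k\<close>.\<close>
    show ?thesis by (rule that[of real]) (auto simp: cos_form_def infinity)
  next
    case (enat n)
    have n: "2 \<le> n" using m_ge_2[OF ab enat] .
    define th where "th = pi / n"
    have th: "0 < th" "th < pi" using n by (auto simp: th_def field_simps)
    then have sp: "0 < sin th" by (rule sin_gt_zero)
    \<comment> \<open>From \<open>k < n\<close> also \<open>Suc k \<le> n\<close>, so both sine
      arguments needed lie in [0, pi].\<close>
    have nonneg: "0 \<le> sin (j * th)" if "j \<le> n" for j :: nat
      using that n th by (intro sin_ge_zero) (auto simp: th_def field_simps)
    show ?thesis
    proof (rule that[of "\<lambda>j. sin (j * th) / sin th"])
      fix j :: nat
      have "sin (Suc (Suc j) * th) = 2 * cos th * sin (Suc j * th) - sin (j * th)"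
        using sin_add[of "Suc j * th" th] sin_diff[of "Suc j * th" th]
        by (simp add: algebra_simps)
      then show "sin (Suc (Suc j) * th) / sin th
          = - 2 * cos_form m a b * (sin (Suc j * th) / sin th) - sin (j * th) / sin th"
        by (simp add: cos_form_def enat diff_divide_distrib flip: th_def)
    qed (use sp k enat nonneg[of k] nonneg[of "Suc k"] in \<open>auto\<close>)
  qed
  show ?thesis
    unfolding act_alt[OF ab(1,2) u]
    by (intro exI[of _ "u (if even k then k else Suc k)"] exI[of _ "u (if even k then Suc k else k)"])
      (simp add: pos add.commute)
qed

text \<open>The proof is the reduction to rank two in Humphreys, Reflection Groups and Coxeter Groups,
  Section 5.4. Minimality of \<open>v\<close> in a factorization \<open>w = v x\<close> with \<open>x\<close> alternating in \<open>a, b\<close> and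
  lengths adding up keeps \<open>v a\<close> and \<open>v b\<close> from being shorter than \<open>v\<close>; and \<open>x\<close> is shorter than
  \<open>m a b\<close>, since otherwise a braid relation would make \<open>w\<close> end in \<open>a\<close>.\<close>

lemma root_nonneg:
  assumes "reduced_word S m w" "a \<in> S"
    and "\<And>w'. weq (w @ [a]) w' \<Longrightarrow> length w \<le> length w'"
  shows "nonneg (act S m w (simple_root a))"
  using assms
proof (induction "length w" arbitrary: w a rule: less_induct)
  case less
  note red = less.prems(1) and a = less.prems(2) and no_shorter = less.prems(3)
  have wS: "w \<in> lists S" using red by (rule reduced_word_lists)
  show ?case
  proof (cases w rule: rev_exhaust)
    case Nil
    then show ?thesis by simp
  next
    case (snoc w0 b)
    have b: "b \<in> S" and w0: "w0 \<in> lists S" using wS snoc by auto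
    \<comment> \<open>The bound \<open>k \<ge> 1\<close> keeps \<open>v\<close> shorter than
      \<open>w\<close>, so that the induction hypothesis applies to \<open>v\<close>.\<close>
    define P where "P = (\<lambda>v. \<exists>k\<ge>1. weq w (v @ alt b a k) \<and> length v + k = length w)"
    have "P w0" using snoc wS by (auto simp: P_def weq_refl intro!: exI[of _ 1])
    then obtain v where "P v" and min: "\<And>v'. P v' \<Longrightarrow> length v \<le> length v'"
      using ex_has_least_nat[of P w0 length] by blast
    then obtain k where k: "1 \<le> k" "weq w (v @ alt b a k)" "length v + k = length w"
      by (auto simp: P_def)
    have v: "v \<in> lists S" using weq_lists[OF k(2)] by simp
    have "reduced_word S m (v @ alt b a k)"
      unfolding reduced_word_iff
      using weq_lists[OF k(2)] weq_trans[OF k(2)] reduced_wordD[OF red] k(3) by auto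
    then have redv: "reduced_word S m v" using reduced_word_factor[of "[]" v] by simp
    have short: False if "weq (w @ [a]) z" "length z < length w" for z
      using no_shorter[OF that(1)] that(2) by simp
    have cancel: "weq (y @ [c] @ [c] @ z) (y @ z)" if "y \<in> lists S" "c \<in> S" "z \<in> lists S" for y z c
      using weq_append[OF weq_refl[OF that(1)] weq_append[OF weq_square[OF that(2)] weq_refl[OF that(3)]]]
      by simp
    have ba: "b \<noteq> a"
    proof
      assume "b = a"
      then have "weq (w @ [a]) w0" using cancel[of w0 a "[]"] w0 a snoc by simp
      then show False using short snoc by auto
    qed
    have extend: "length v \<le> length v'" if c: "c \<in> {a, b}" and v': "weq (v @ [c]) v'" for c v'
    proof (rule ccontr)
      assume "\<not> ?thesis"
      then have lt: "length v' < length v" by simp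
      have cS: "c \<in> S" using c a b by auto
      have v'S: "v' \<in> lists S" using weq_lists[OF v'] by simp
      have "weq (v @ [c] @ [c]) (v' @ [c])"
        using weq_append[OF v' weq_refl[of "[c]"]] cS by simp
      moreover have "weq (v @ [c] @ [c]) v" using cancel[OF v cS, of "[]"] by simp
      ultimately have vv': "weq v (v' @ [c])" by (blast intro: weq_trans weq_sym)
      from reduced_wordD[OF redv this] have "length v \<le> Suc (length v')" by simp
      with lt have len: "length v = Suc (length v')" by simp
      have altS: "alt b a j \<in> lists S" for j using a b by (rule alt_in_lists[rotated])
      have wv': "weq w (v' @ [c] @ alt b a k)"
        using weq_trans[OF k(2) weq_append[OF vv' weq_refl[OF altS]]] by simp
      show False
      \<comment> \<open>Either \<open>c\<close> prolongs the alternating word on the left, and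
        \<open>v'\<close> contradicts the minimality of \<open>v\<close>; or \<open>c\<close>
        cancels its first letter, and \<open>w\<close> gets a shorter expression.\<close>
      proof (cases "c = (if even k then b else a)")
        case True
        then have "P v'" unfolding P_def using wv' len k by (intro exI[of _ "Suc k"]) auto
        from min[OF this] show False using lt by simp
      next
        case False
        obtain j where j: "k = Suc j" using k(1) by (cases k) auto
        with False c have "c = (if even j then b else a)" by auto
        then have "weq w (v' @ [c] @ [c] @ alt b a j)" using wv' j by simp
        from weq_trans[OF this cancel[OF v'S cS altS]] have "weq w (v' @ alt b a j)" .
        from reduced_wordD[OF red this] show False using len k j by simp
      qed
    qed
    have lt: "length v < length w" using k by simp
    have va: "nonneg (act S m v (simple_root a))"
      using extend by (intro less.hyps[OF lt redv a]) auto
    have vb: "nonneg (act S m v (simple_root b))"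
      using extend by (intro less.hyps[OF lt redv b]) auto
    have "enat k < m b a"
    proof (rule ccontr)
      assume "\<not> ?thesis"
      then obtain n where n: "m b a = enat n" "n \<le> k" by (cases "m b a") auto
      have n2: "2 \<le> n" using m_ge_2[OF b a ba n(1)] .
      obtain y where y: "length y = k - n" "alt b a k = y @ alt b a n"
        using alt_add[of "k - n" b a n] n by auto
      obtain z where z: "length z = n - 1" "alt a b n = z @ [a]"
        using alt_snoc[of "n - 1" a b] n2 by auto
      have yS: "y \<in> lists S" using alt_in_lists[OF b a, of k] y by simp
      have zS: "z \<in> lists S" using alt_in_lists[OF a b, of n] z by simp
      have "weq w (v @ y @ z @ [a])"
        using weq_trans[OF k(2)] weq_append[OF weq_refl[OF v] weq_append[OF weq_refl[OF yS]
            weq_braid[OF b a n(1)]]] y z by simp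
      then have "weq (w @ [a]) (((v @ y @ z) @ [a]) @ [a])"
        using a by (intro weq_append) (auto simp: weq_refl)
      moreover have "weq (((v @ y @ z) @ [a]) @ [a]) (v @ y @ z)"
        using cancel[of "v @ y @ z" a "[]"] v yS zS a by simp
      ultimately have "weq (w @ [a]) (v @ y @ z)" by (rule weq_trans)
      moreover have "length (v @ y @ z) < length w" using y(1) z(1) k(3) n(2) n2 by simp
      ultimately show False by (rule short)
    qed
    from act_alt_nonneg[OF b a ba this] obtain y z where yz: "0 \<le> y" "0 \<le> z"
      "act S m (alt b a k) (simple_root a) = (\<lambda>x. y * simple_root b x + z * simple_root a x)"
      by blast
    have "act S m w (simple_root a) =
        (\<lambda>x. y * act S m v (simple_root b) x + z * act S m v (simple_root a) x)"
      using weq_act[OF k(2)] yz(3) by (simp add: act_lin)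
    then show ?thesis using va vb yz(1,2) by (simp add: nonneg_add nonneg_scale)
  qed
qed

lemma reduced_root_nonneg:
  assumes "reduced_word S m (w @ [a])"
  shows "nonneg (act S m w (simple_root a))"
proof (rule root_nonneg)
  show "reduced_word S m w" using reduced_word_factor[of "[]" w "[a]"] assms by simp
  show "a \<in> S" using reduced_word_lists[OF assms] by simp
  show "length w \<le> length w'" if "weq (w @ [a]) w'" for w'
    using reduced_wordD[OF assms that] by simp
qed

lemma act_inj:
  assumes "u \<in> lists S"
  shows "inj (act S m u)"
  using assms
proof (induction u)
  case (Cons a u)
  then have "inj (reflect S m a)" by (metis Cons_in_lists_iff injI reflect_reflect)
  with Cons show ?case by (auto simp: comp_def dest: inj_compose)
qed (simp add: inj_on_def)

text \<open>Otherwise \<open>w a\<close> has a reduced expression \<open>z\<close> no longer than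
  \<open>w\<close>, and \<open>w = z a\<close> in the group. Then \<open>z a\<close> is not shorter
  than \<open>z\<close>, so \<open>z\<close> sends the root of \<open>a\<close> to a nonnegative
  vector; this is minus the image under \<open>w\<close>, so both vanish, against
  injectivity.\<close>

lemma reduced_word_snoc:
  assumes red: "reduced_word S m w" and a: "a \<in> S"
    and nonneg: "nonneg (act S m w (simple_root a))"
  shows "reduced_word S m (w @ [a])"
proof (rule ccontr)
  assume not_red: "\<not> ?thesis"
  have wS: "w \<in> lists S" using red by (rule reduced_word_lists)
  obtain z where z: "weq (w @ [a]) z" "reduced_word S m z"
    using ex_reduced_word[of "w @ [a]"] wS a by auto
  have "length z \<le> length w"
  proof (rule ccontr)
    assume "\<not> ?thesis"
    moreover have "length z \<le> length v" if "weq (w @ [a]) v" for v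
      using reduced_wordD[OF z(2)] weq_trans[OF weq_sym[OF z(1)] that] by blast
    ultimately show False using not_red wS a by (fastforce simp: reduced_word_iff)
  qed
  have "weq (w @ [a, a]) (z @ [a])"
    using weq_append[OF z(1) weq_refl[of "[a]"]] a by simp
  moreover have "weq (w @ [a, a]) w"
    using weq_append[OF weq_refl[OF wS] weq_square[OF a]] by simp
  ultimately have "weq w (z @ [a])" using weq_trans weq_sym by blast
  then have "length z \<le> length v" if "weq (z @ [a]) v" for v
    using reduced_wordD[OF red weq_trans[OF _ that]] \<open>length z \<le> length w\<close> by simp
  then have "nonneg (act S m z (simple_root a))" by (rule root_nonneg[OF z(2) a])
  moreover have "act S m z (simple_root a) = (\<lambda>x. - act S m w (simple_root a) x)"
  proof -
    have "reflect S m a (simple_root a) = (\<lambda>x. (-1) * simple_root a x)"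
      using reflect_simple_root[OF a a] cos_form_diag[OF a] by (auto simp: fun_eq_iff)
    then have "act S m (w @ [a]) (simple_root a) = (\<lambda>x. (-1) * act S m w (simple_root a) x)"
      using act_scale[of S m w "-1" "simple_root a"] by simp
    then show ?thesis using weq_act[OF z(1)] by simp
  qed
  ultimately have "act S m w (simple_root a) x \<le> 0" "0 \<le> act S m w (simple_root a) x" for x
    using nonneg by (simp_all add: nonneg_def)
  then have "act S m w (simple_root a) x = 0" for x by (rule order_antisym)
  then have "act S m w (simple_root a) = act S m w (\<lambda>x. 0)"
    using act_scale[of S m w 0 "simple_root a"] by auto
  then have "simple_root a = (\<lambda>x. 0)" by (rule injD[OF act_inj[OF wS]])
  then have "simple_root a a = 0" by (rule fun_cong)
  then show False by (simp add: simple_root_def)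
qed

lemma reduced_word_if_roots_nonneg:
  assumes "w \<in> lists S"
    and "\<And>p a q. w = p @ a # q \<Longrightarrow> nonneg (act S m p (simple_root a))"
  shows "reduced_word S m w"
  using assms
proof (induction w rule: rev_induct)
  case Nil
  show ?case by (simp add: reduced_word_iff)
next
  case (snoc a w)
  have "reduced_word S m w"
  proof (rule snoc.IH)
    show "w \<in> lists S" using snoc.prems(1) by simp
    show "nonneg (act S m p (simple_root b))" if "w = p @ b # q" for p b q
      using snoc.prems(2)[of p b "q @ [a]"] that by simp
  qed
  moreover have "a \<in> S" using snoc.prems(1) by simp
  moreover have "nonneg (act S m w (simple_root a))" using snoc.prems(2)[of w a "[]"] by simp
  ultimately show ?case by (rule reduced_word_snoc)
qed

end

section \<open>Adjoining a generator\<close>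

text \<open>Used to decide in which block of the interleaved word a given prefix ends.\<close>

lemma append_eq_append_Cons_conv:
  "xs @ ys = p @ a # q \<longleftrightarrow>
    (\<exists>r. xs = p @ a # r \<and> q = r @ ys) \<or> (\<exists>r. p = xs @ r \<and> ys = r @ a # q)"
  by (auto simp: append_eq_append_conv2 append_eq_Cons_conv Cons_eq_append_conv)

locale coxeter_extension =
  old: coxeter_system S m + new: coxeter_system "insert s S" m'
  for S :: "'a set" and m m' :: "'a \<Rightarrow> 'a \<Rightarrow> enat" and s :: 'a +
  fixes t :: 'a
  assumes s_new: "s \<notin> S" and t_old: "t \<in> S"
    and m'_old: "a \<in> S \<Longrightarrow> b \<in> S \<Longrightarrow> m' a b = m a b"
    and m'_st: "m' s t \<ge> 3"
    and m'_s: "a \<in> S \<Longrightarrow> a \<noteq> t \<Longrightarrow> m' s a = 2"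
begin

section \<open>The representation of the larger group\<close>

abbreviation refl' :: "'a \<Rightarrow> ('a \<Rightarrow> real) \<Rightarrow> 'a \<Rightarrow> real" where
  "refl' \<equiv> reflect (insert s S) m'"

abbreviation act' :: "'a list \<Rightarrow> ('a \<Rightarrow> real) \<Rightarrow> 'a \<Rightarrow> real" where
  "act' \<equiv> act (insert s S) m'"

definition bond :: real where
  "bond = - 2 * cos_form m' s t"

lemma s_neq_t: "s \<noteq> t"
  using s_new t_old by blast

text \<open>Cosine decreases on [0, pi] and \<open>cos (pi / 3)\<close> is 1/2; this is where
  \<open>m' s t \<ge> 3\<close> enters.\<close>

lemma bond_ge_1: "1 \<le> bond"
proof (cases "m' s t")
  case infinity
  then show ?thesis by (simp add: bond_def cos_form_def)
next
  case (enat k)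
  then have k: "3 \<le> k" using m'_st by (simp add: numeral_eq_enat)
  have "cos (pi / 3) \<le> cos (pi / k)"
    using k by (intro cos_monotone_0_pi_le) (auto simp: field_simps)
  then show ?thesis by (simp add: bond_def cos_form_def enat cos_60)
qed

lemma cos_form_s: "a \<in> S \<Longrightarrow> a \<noteq> t \<Longrightarrow> cos_form m' s a = 0"
  using m'_s[of a] by (simp add: cos_form_def numeral_eq_enat)

text \<open>A bond of strength 2 makes roots orthogonal, so \<open>t\<close> is the only old
  coordinate that contributes.\<close>

lemma reflect_s: "refl' s f = f(s := bond * f t - f s)"
proof -
  have "(\<Sum>b\<in>S. cos_form m' s b * f b) = (\<Sum>b\<in>S. if b = t then cos_form m' s t * f t else 0)"
    using cos_form_s by (intro sum.cong) auto
  then have "(\<Sum>b\<in>S. cos_form m' s b * f b) = cos_form m' s t * f t"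
    using old.finS t_old by simp
  then have "pairing (insert s S) m' s f = f s + cos_form m' s t * f t"
    using old.finS s_new new.cos_form_diag[of s] by (simp add: pairing_def)
  then show ?thesis by (simp add: fun_eq_iff reflect_def bond_def)
qed

lemma reflect_simple_root_s:
  assumes "b \<in> S"
  shows "refl' b (simple_root s) =
    (\<lambda>x. simple_root s x + (if b = t then bond else 0) * simple_root b x)"
  using new.reflect_simple_root[of b s] new.cos_form_sym[of s b] cos_form_s[of b] assms
  by (auto simp: bond_def fun_eq_iff)

lemma act_at_s: "w \<in> lists S \<Longrightarrow> act' w f s = f s"
  using s_new by (induction w) (auto simp: reflect_def)

text \<open>Vectors without \<open>s\<close>-coordinate carry the old representation, so positivity
  of roots carries over from the smaller group.\<close>

lemma reflect_old:
  assumes "a \<in> S" "f s = 0"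
  shows "refl' a f = reflect S m a f"
proof -
  have "(\<Sum>b\<in>S. cos_form m' a b * f b) = (\<Sum>b\<in>S. cos_form m a b * f b)"
    using m'_old assms(1) by (intro sum.cong) (auto simp: cos_form_def)
  then show ?thesis
    using old.finS s_new assms(2) by (simp add: reflect_def pairing_def)
qed

lemma act_old: "w \<in> lists S \<Longrightarrow> f s = 0 \<Longrightarrow> act' w f = act S m w f"
proof (induction w)
  case (Cons a w)
  then have "act S m w f s = 0" using act_at_s[of w f] by simp
  with Cons show ?case using reflect_old by simp
qed simp

lemma act_root_nonneg:
  assumes "reduced_word S m (p @ w @ a # q)"
  shows "nonneg (act' w (simple_root a))"
proof -
  have red: "reduced_word S m (w @ [a])"
    using old.reduced_word_factor[of p "w @ [a]" q] assms by simp
  then have "w \<in> lists S" "a \<in> S" using old.reduced_word_lists by fastforce+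
  moreover from this have "simple_root a s = 0" using s_new by (auto simp: simple_root_def)
  ultimately show ?thesis using old.reduced_root_nonneg[OF red] act_old[of w "simple_root a"] by simp
qed

section \<open>What the new coordinate contributes to the old ones\<close>

definition shift :: "'a list \<Rightarrow> 'a \<Rightarrow> real" where
  "shift w = (\<lambda>x. act' w (simple_root s) x - simple_root s x)"

lemma act_simple_root_s: "act' w (simple_root s) = (\<lambda>x. simple_root s x + shift w x)"
  by (simp add: shift_def)

lemma shift_Cons:
  assumes "b \<in> S"
  shows "shift (b # w) = (\<lambda>x. (if b = t then bond else 0) * simple_root b x + refl' b (shift w) x)"
proof -
  have "act' (b # w) (simple_root s) =
      (\<lambda>x. refl' b (simple_root s) x + refl' b (shift w) x)"
    using act_add[of "insert s S" m' "[b]" "simple_root s" "shift w"] act_simple_root_s[of w] by simp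
  then show ?thesis
    using reflect_simple_root_s[OF assms] by (simp add: shift_def)
qed

lemma act_zero: "act' w (\<lambda>x. 0) = (\<lambda>x. 0)"
  using act_scale[of "insert s S" m' w 0 "\<lambda>x. 0"] by simp

text \<open>Each \<open>t\<close> in \<open>w = p t q\<close> contributes \<open>bond\<close> times
  the image of the root of \<open>t\<close> under \<open>z p\<close>, and \<open>z p t\<close> is a
  prefix of a reduced word. In the induction \<open>z\<close> absorbs the letters of
  \<open>w\<close>.\<close>

lemma act_shift_nonneg: "reduced_word S m (z @ w) \<Longrightarrow> nonneg (act' z (shift w))"
proof (induction w arbitrary: z)
  case Nil
  have "shift [] = (\<lambda>x. 0)" by (simp add: shift_def)
  then show ?case using act_zero by (simp add: nonneg_def)
next
  case (Cons b w)
  have b: "b \<in> S" using old.reduced_word_lists[OF Cons.prems] by simp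
  have "nonneg (act' z (simple_root b))" using act_root_nonneg[of "[]" z b w] Cons.prems by simp
  moreover have "nonneg (act' z (refl' b (shift w)))" using Cons.IH[of "z @ [b]"] Cons.prems by simp
  ultimately show ?case
    using bond_ge_1 unfolding shift_Cons[OF b] act_add act_scale
    by (intro nonneg_add nonneg_scale) auto
qed

text \<open>The leftmost \<open>t\<close> adds \<open>bond\<close> to a nonnegative coordinate, and
  the letters before it leave that coordinate alone.\<close>

lemma shift_at_t:
  "reduced_word S m w \<Longrightarrow> t \<in> set w \<Longrightarrow> bond \<le> shift w t"
proof (induction w)
  case (Cons b w)
  have b: "b \<in> S" using old.reduced_word_lists[OF Cons.prems(1)] by simp
  have red: "reduced_word S m w" using old.reduced_word_factor[of "[b]" w "[]"] Cons.prems by simp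
  show ?case
  proof (cases "b = t")
    case True
    have "nonneg (act' [b] (shift w))" using act_shift_nonneg[of "[b]" w] Cons.prems by simp
    then have "0 \<le> refl' b (shift w) t" by (simp add: nonneg_def)
    then show ?thesis unfolding shift_Cons[OF b] using True by (simp add: simple_root_def)
  next
    case False
    then show ?thesis unfolding shift_Cons[OF b] using Cons red by (simp add: reflect_def)
  qed
qed simp

text \<open>With \<open>f = v + k \<alpha>\<^sub>s\<close>, \<open>k\<close> is \<open>f s\<close> and \<open>v\<close> is \<open>f(s := 0)\<close>.\<close>

definition good :: "'a list \<Rightarrow> ('a \<Rightarrow> real) \<Rightarrow> bool" where
  "good y f \<longleftrightarrow> 0 \<le> f s \<and> (\<forall>z. suffix z y \<longrightarrow> nonneg (act' z (f(s := 0))))"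

text \<open>Letters act from right to left, so \<open>good\<close> tests every intermediate stage of
  the word; the letters acting last may be dropped.\<close>

lemma good_suffix: "good (y @ w) f \<Longrightarrow> good w f"
  by (auto simp: good_def suffix_appendI)

lemma good_Nil: "good [] f \<Longrightarrow> nonneg f"
  by (auto simp: good_def nonneg_def split: if_splits)

lemma good_root:
  assumes "reduced_word S m (y @ a # q)"
  shows "good y (simple_root a)"
proof -
  have "a \<in> S" using old.reduced_word_lists[OF assms] by simp
  then have "simple_root a s = 0" "(simple_root a)(s := 0) = simple_root a"
    using s_new by (auto simp: simple_root_def)
  moreover have "nonneg (act' z (simple_root a))" if "suffix z y" for z
    using that assms act_root_nonneg[of _ z a q] by (auto elim!: suffixE)
  ultimately show ?thesis by (simp add: good_def)
qed

lemma good_root_s: "good y (simple_root s)"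
proof -
  have "(simple_root s)(s := 0) = (\<lambda>x. 0)" by (auto simp: simple_root_def)
  then show ?thesis using act_zero by (simp add: good_def nonneg_def simple_root_def)
qed

text \<open>The letter \<open>s\<close> leaves \<open>f(s := 0)\<close> alone, so only the sign of
  the new coefficient is at stake.\<close>

lemma good_reflect_s: "good y f \<Longrightarrow> f s \<le> bond * f t \<Longrightarrow> good y (refl' s f)"
  by (simp add: good_def reflect_s)

lemma act_split: "act' w f = (\<lambda>x. act' w (f(s := 0)) x + f s * act' w (simple_root s) x)"
proof -
  have "f = (\<lambda>x. 1 * (f(s := 0)) x + f s * simple_root s x)"
    by (auto simp: simple_root_def)
  then show ?thesis using act_lin[of "insert s S" m' w 1 "f(s := 0)" "f s" "simple_root s"] by simp
qed

text \<open>The new old part is \<open>w\<close> applied to the former one plus \<open>f s\<close>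
  times \<open>shift w\<close>. Under a suffix \<open>z\<close> of \<open>y\<close> the first term
  stays nonnegative since \<open>z @ w\<close> is a suffix of \<open>y @ w\<close>, the second since
  \<open>z @ w\<close> is reduced.\<close>

lemma good_act:
  assumes red: "reduced_word S m (y @ w)" and good: "good (y @ w) f"
  shows "good y (act' w f)"
proof -
  have w: "w \<in> lists S" using old.reduced_word_lists[OF red] by simp
  have "(act' w f)(s := 0) = (\<lambda>x. act' w (f(s := 0)) x + f s * shift w x)"
    using act_at_s[OF w, of "f(s := 0)"] act_at_s[OF w, of "simple_root s"]
    by (subst act_split) (auto simp: shift_def simple_root_def)
  moreover have "nonneg (act' z (\<lambda>x. act' w (f(s := 0)) x + f s * shift w x))" if z: "suffix z y" for z
  proof -
    obtain p where p: "y = p @ z" using z by (auto simp: suffix_def)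
    then have "nonneg (act' (z @ w) (f(s := 0)))"
      using good by (auto simp: good_def suffix_def)
    moreover have "nonneg (act' z (shift w))"
      using old.reduced_word_factor[of p "z @ w" "[]"] red p by (intro act_shift_nonneg) simp
    ultimately show ?thesis
      using good unfolding act_add act_scale by (intro nonneg_add nonneg_scale) (auto simp: good_def)
  qed
  ultimately show ?thesis using good act_at_s[OF w] by (simp add: good_def)
qed

text \<open>An occurrence of \<open>t\<close> brings the \<open>t\<close>-coordinate up to at least
  \<open>f s\<close>, which is what \<open>good_reflect_s\<close> asks before the next
  \<open>s\<close>.\<close>

lemma act_at_t:
  assumes red: "reduced_word S m w" and t: "t \<in> set w" and good: "good w f"
  shows "act' w f s \<le> bond * act' w f t"
proof -
  have w: "w \<in> lists S" using old.reduced_word_lists[OF red] .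
  have k: "0 \<le> f s" using good by (simp add: good_def)
  have "nonneg (act' w (f(s := 0)))" using good by (simp add: good_def)
  then have "0 \<le> act' w (f(s := 0)) t" by (simp add: nonneg_def)
  moreover have "act' w (simple_root s) t = shift w t"
    using s_neq_t by (simp add: shift_def simple_root_def)
  moreover have "f s * 1 \<le> f s * shift w t"
    using k shift_at_t[OF red t] bond_ge_1 by (intro mult_left_mono) auto
  ultimately have "f s \<le> act' w f t" by (subst act_split) simp
  moreover have "1 * act' w f t \<le> bond * act' w f t"
    using calculation k bond_ge_1 by (intro mult_right_mono) auto
  ultimately show ?thesis using act_at_s[OF w] by simp
qed

section \<open>Positivity along the interleaved word\<close>

lemma reduced_interleaved:
  fixes word :: "nat \<Rightarrow> 'a list"
  assumes n: "n \<ge> 1"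
    and red: "reduced_word S m (concat (map word [1..<n + 1]))"
    and t: "\<And>i. 2 \<le> i \<Longrightarrow> i \<le> n - 1 \<Longrightarrow> t \<in> set (word i)"
  shows "reduced_word (insert s S) m' (concat (map (\<lambda>i. word i @ [s]) [1..<n]) @ word n)"
proof -
  define Y where "Y j = concat (map word [1..<j])" for j
  define E where "E j = concat (map (\<lambda>i. word i @ [s]) [1..<j])" for j
  have Y_Suc: "Y (Suc j) = Y j @ word j" if "1 \<le> j" for j
    using that by (simp add: Y_def)
  have E_Suc: "E (Suc j) = E j @ word j @ [s]" if "1 \<le> j" for j
    using that by (simp add: E_def)
  have redY: "reduced_word S m (Y j @ word j)" if "1 \<le> j" "j \<le> n" for j
  proof -
    have "[1..<n + 1] = [1..<Suc j] @ [Suc j..<n + 1]"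
      using upt_add_eq_append[of 1 "Suc j" "n - j"] that by simp
    then have "reduced_word S m ([] @ Y (Suc j) @ concat (map word [Suc j..<n + 1]))"
      using red by (simp add: Y_def)
    then have "reduced_word S m (Y (Suc j))" by (rule old.reduced_word_factor)
    then show ?thesis by (simp only: Y_Suc[OF that(1)])
  qed
  have redw: "reduced_word S m (word j)" if "1 \<le> j" "j \<le> n" for j
    using old.reduced_word_factor[of "Y j" "word j" "[]"] redY[OF that] by simp
  have wordS: "word j \<in> lists S" if "1 \<le> j" "j \<le> n" for j
    using old.reduced_word_lists[OF redw[OF that]] .
  \<comment> \<open>\<open>E j\<close> is consumed from its right end. For \<open>j \<ge> 2\<close>
    its last letter is \<open>s\<close>, and the final hypothesis keeps the coefficient nonnegative
    there.\<close>
  have act_E: "nonneg (act' (E j) f)"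
    if "1 \<le> j" "j \<le> n" "good (Y j) f" "2 \<le> j \<Longrightarrow> f s \<le> bond * f t" for j f
    using that
  proof (induction j arbitrary: f rule: nat_induct_at_least)
    case base
    then show ?case using good_Nil by (simp add: Y_def E_def)
  next
    case (Suc j)
    have j: "1 \<le> j" "j \<le> n" using Suc by simp_all
    have good: "good (Y j @ word j) (refl' s f)"
      using Suc.prems(2,3) Suc.hyps Y_Suc[OF j(1)] by (intro good_reflect_s) auto
    then have "good (Y j) (act' (word j) (refl' s f))" using redY[OF j] by (intro good_act)
    \<comment> \<open>This prepares the \<open>s\<close> after block \<open>j - 1\<close>; before
      block 1 there is none.\<close>
    moreover have "act' (word j) (refl' s f) s \<le> bond * act' (word j) (refl' s f) t" if "2 \<le> j"
    proof (rule act_at_t[OF redw[OF j]])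
      show "t \<in> set (word j)" using t[of j] that Suc.prems(1) by simp
      show "good (word j) (refl' s f)" using good by (rule good_suffix)
    qed
    ultimately have "nonneg (act' (E j) (act' (word j) (refl' s f)))"
      using Suc.IH j by blast
    then show ?case using E_Suc[OF j(1)] by simp
  qed
  have root_word: "nonneg (act' (E j @ p) (simple_root a))"
    if j: "1 \<le> j" "j \<le> n" and p: "word j = p @ a # q" for j p a q
  proof -
    have red': "reduced_word S m ((Y j @ p) @ a # q)" using redY[OF j] p by simp
    have "a \<in> S" "p \<in> lists S" using wordS[OF j] p by auto
    then have s0: "act' p (simple_root a) s = 0"
      using s_new act_at_s by (auto simp: simple_root_def)
    have "good (Y j) (act' p (simple_root a))"
    proof (rule good_act)
      show "reduced_word S m (Y j @ p)"
        using old.reduced_word_factor[of "[]" "Y j @ p" "a # q"] red' by simp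
      show "good (Y j @ p) (simple_root a)" using good_root[OF red'] .
    qed
    \<comment> \<open>The \<open>s\<close>-coordinate is still 0, so nonnegativity at
      \<open>t\<close> suffices for the next \<open>s\<close>, whether or not \<open>t\<close>
      occurs in \<open>p\<close>.\<close>
    moreover have "0 \<le> act' p (simple_root a) t"
      using act_root_nonneg[of "Y j" p a q] red' by (simp add: nonneg_def)
    ultimately show ?thesis using act_E[OF j] s0 bond_ge_1 by simp
  qed
  \<comment> \<open>The coefficient of the new root is 1 from the start, so block \<open>j\<close>
    must contain \<open>t\<close> if another \<open>s\<close> precedes it; \<open>j < n\<close> puts
    it among the blocks known to.\<close>
  have root_s: "nonneg (act' (E j @ word j) (simple_root s))" if j: "1 \<le> j" "j < n" for j
  proof -
    have j': "j \<le> n" using j by simp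
    have "act' (word j) (simple_root s) s \<le> bond * act' (word j) (simple_root s) t" if "2 \<le> j"
    proof (rule act_at_t[OF redw[OF j(1) j'] _ good_root_s])
      show "t \<in> set (word j)" using t[of j] that j by simp
    qed
    moreover have "good (Y j) (act' (word j) (simple_root s))"
      using redY[OF j(1) j'] good_root_s by (intro good_act)
    ultimately show ?thesis using act_E[OF j(1) j'] by simp
  qed
  have root_E: "nonneg (act' p (simple_root a))"
    if "1 \<le> j" "j \<le> n" "E j = p @ a # q" for j p a q
    using that
  proof (induction j arbitrary: p a q rule: nat_induct_at_least)
    case base
    then show ?case by (simp add: E_def)
  next
    case (Suc j)
    have j: "1 \<le> j" "j < n" using Suc by simp_all
    from Suc.prems E_Suc[OF j(1)] have "E j @ word j @ [s] = p @ a # q" by simp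
    then consider r where "E j = p @ a # r" | r where "p = E j @ r" "word j @ [s] = r @ a # q"
      unfolding append_eq_append_Cons_conv by blast
    then show ?case
    proof cases
      case 1
      then show ?thesis using Suc.IH j by simp
    next
      case 2
      from 2(2) consider q' where "word j = r @ a # q'" | "r = word j" "a = s"
        unfolding append_eq_append_Cons_conv by (auto simp: Cons_eq_append_conv)
      then show ?thesis using 2(1) root_word[of j r a] root_s[OF j] j by cases auto
    qed
  qed
  have "reduced_word (insert s S) m' (E n @ word n)"
  proof (rule new.reduced_word_if_roots_nonneg)
    have "E n \<in> lists (insert s S)"
      using wordS by (auto simp: E_def in_lists_conv_set split: if_splits)
    then show "E n @ word n \<in> lists (insert s S)" using wordS[OF n order_refl] by auto
    fix p a q assume "E n @ word n = p @ a # q"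
    then consider r where "E n = p @ a # r" | r where "p = E n @ r" "word n = r @ a # q"
      unfolding append_eq_append_Cons_conv by blast
    then show "nonneg (act' p (simple_root a))"
      using root_E[OF n order_refl] root_word[OF n order_refl] by cases auto
  qed
  then show ?thesis by (simp add: E_def)
qed

end

text \<open>Moves each \<open>s\<close> to the end of the preceding block, so that initial segments
  end in \<open>s\<close>.\<close>

lemma concat_interleave:
  assumes "1 \<le> n"
  shows "word 1 @ concat (map (\<lambda>i. s # word i) [2..<n + 1]) =
    concat (map (\<lambda>i. word i @ [s]) [1..<n]) @ word n"
  using assms
proof (induction n rule: nat_induct_at_least)
  case (Suc n)
  then have "[2..<Suc n + 1] = [2..<n + 1] @ [Suc n]" "[1..<Suc n] = [1..<n] @ [n]"
    by (simp_all add: upt_Suc)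
  then show ?case using Suc.IH by simp
qed simp

theorem lemma6p2:
  fixes S :: "'a set" and m m' :: "'a \<Rightarrow> 'a \<Rightarrow> enat" and s t :: 'a
    and n :: nat and word :: "nat \<Rightarrow> 'a list" and w :: "nat \<Rightarrow> 'a letter list set"
  assumes "coxeter_matrix S m"
    and "s \<notin> S" and "t \<in> S"
    and "coxeter_matrix (insert s S) m'"
    and "\<And>a b. a \<in> S \<Longrightarrow> b \<in> S \<Longrightarrow> m' a b = m a b"
    and "m' s t \<ge> 3"
    and "\<And>s'. s' \<in> S \<Longrightarrow> s' \<noteq> t \<Longrightarrow> m' s s' = 2"
    and "n \<ge> 1"
    and "\<And>i. 1 \<le> i \<Longrightarrow> i \<le> n \<Longrightarrow> w i \<in> carrier (coxeter_group S m)"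
    and "\<And>i. 1 \<le> i \<Longrightarrow> i \<le> n \<Longrightarrow> reduced_expression_for S m (word i) (w i)"
    and "reduced_word S m (concat (map word [1..<n + 1]))"
    and "\<And>i. 2 \<le> i \<Longrightarrow> i \<le> n - 1 \<Longrightarrow> t \<in> set (word i)"
  shows "\<exists>g \<in> carrier (coxeter_group (insert s S) m').
           reduced_expression_for (insert s S) m' (word 1 @ concat (map (\<lambda>i. s # word i) [2..<n + 1])) g"
proof -
  interpret coxeter_extension S m m' s t
    by standard (use assms in auto)
  define u where "u = word 1 @ concat (map (\<lambda>i. s # word i) [2..<n + 1])"
  have red: "reduced_word (insert s S) m' u"
    unfolding u_def concat_interleave[OF assms(8)]
    using assms(8,11,12) by (rule reduced_interleaved)
  then have "map Gen u \<in> gwords (insert s S)"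
    unfolding new.map_Gen_gwords by (rule new.reduced_word_lists)
  then have "coxeter_elem (insert s S) m' u \<in> carrier (coxeter_group (insert s S) m')"
    by (simp add: coxeter_elem_def coxeter_group_def presented_group_def)
  with red show ?thesis unfolding u_def reduced_word_def by blast
qed

end
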